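(* Let $\mathcal{Q}=\{A_2\}$. Then for every integer $n\ge 2$, $$s_n(\mathcal{Q}\cup\{B_1\})=\sum_{k=1}^{n-1}\binom{n-k+2}{2}t(n-2,k-1)+C(n-1)=\frac{1}{n+2}\binom{2n+2}{n+1},$$ $$s_n(\mathcal{Q}\cup\{B_2\})=\sum_{k=1}^{n-1}(n-k+1)\,t(n-2,k-1)+C(n-1)=\frac{2}{n+1}\binom{2n}{n},$$ $$s_n(\mathcal{Q}\cup\{B_3\})=C(n-1)+C(n-2),$$ $$s_n(\mathcal{Q}\cup\{B_4\})=\sum_{k=1}^{n-1}(n+k-1)\,t(n-2,k-1)+C(n-1)=2\binom{2n-2}{n-1},$$ $$s_n(\mathcal{Q}\cup\{B_5\})=\sum_{k=1}^{n-1}(n+k-1)(n-k+1)\,t(n-2,k-1)+C(n-1)=\frac{2n^2+4}{(n+1)(n+2)}\binom{2n}{n},$$ $$s_n(\mathcal{Q}\cup\{B_6\})=\sum_{k=1}^{n-1}\binom{n+k}{2}t(n-2,k-1)+C(n-1)=\frac{n^2-n+4}{4n-2}\binom{2n+1}{n-1}.$$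
   Context: A standard piece is a $2\times 2$ matrix whose four entries are $1,2,3,4$, each occurring exactly once. For $n\ge 1$, a standard $n$-puzzle is a $2\times(n+1)$ matrix whose entries are $1,2,\dots,2n+2$, each occurring exactly once; its pieces are its $n$ submatrices formed by two consecutive columns. The reduction of a piece is the standard piece obtained by replacing its four distinct entries by $1,2,3,4$ in an order-preserving way. A set $\mathcal{P}$ of standard pieces is a support of a puzzle if the reduction of each piece of the puzzle lies in $\mathcal{P}$. $S_n(\mathcal{P})$ is the set of standard $n$-puzzles having $\mathcal{P}$ as a support, and $s_n(\mathcal{P})=|S_n(\mathcal{P})|$. The standard pieces used are $A_2=\left[\begin{smallmatrix}3&4\\1&2\end{smallmatrix}\right]$, and $B_1=\left[\begin{smallmatrix}4&2\\1&3\end{smallmatrix}\right]$, $B_2=\left[\begin{smallmatrix}3&2\\1&4\end{smallmatrix}\right]$, $B_3=\left[\begin{smallmatrix}2&3\\1&4\end{smallmatrix}\right]$, $B_4=\left[\begin{smallmatrix}3&1\\2&4\end{smallmatrix}\right]$, $B_5=\left[\begin{smallmatrix}4&1\\2&3\end{smallmatrix}\right]$, $B_6=\left[\begin{smallmatrix}4&1\\3&2\end{smallmatrix}\right]$. $C(m)=\frac{1}{m+2}\binom{2m+2}{m+1}$ for $m\ge 0$ (shifted Catalan numbers: $C(0)=1$, $C(1)=2$, $C(2)=5,\dots$). $t(n,k)=\frac{n-k+1}{n+1}\binom{n+k}{n}$ for $0\le k\le n$ (Catalan's triangle, OEIS A009766). *)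

theory Defs
  imports Complex_Main "Jordan_Normal_Form.Matrix"
begin

text \<open>Row 0 of a matrix is its top row.\<close>

definition standard_matrix :: "nat \<Rightarrow> nat mat \<Rightarrow> bool" where
  "standard_matrix c M \<longleftrightarrow>
     M \<in> carrier_mat 2 c \<and>
     bij_betw (\<lambda>(i, j). M $$ (i, j)) ({0..<2} \<times> {0..<c}) {1..2 * c}"

definition standard_piece :: "nat mat \<Rightarrow> bool" where
  "standard_piece M \<longleftrightarrow> standard_matrix 2 M"

definition standard_puzzle :: "nat \<Rightarrow> nat mat \<Rightarrow> bool" where
  "standard_puzzle n M \<longleftrightarrow> standard_matrix (n + 1) M"

definition piece :: "nat mat \<Rightarrow> nat \<Rightarrow> nat mat" where
  "piece M p = mat 2 2 (\<lambda>(i, j). M $$ (i, p + j))"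

definition pieces :: "nat mat \<Rightarrow> nat mat set" where
  "pieces M = {piece M p | p. p + 1 < dim_col M}"

text \<open>The order-preserving replacement of the entries by an initial segment
  \<open>1, 2, \<dots>\<close> sends every entry to its rank; see \<open>reduction_standard_piece\<close> and
  \<open>reduction_less_iff\<close> below.\<close>

definition reduction :: "nat mat \<Rightarrow> nat mat" where
  "reduction M = map_mat (\<lambda>x. card {y \<in> elements_mat M. y \<le> x}) M"

definition is_support :: "nat mat set \<Rightarrow> nat mat \<Rightarrow> bool" where
  "is_support P M \<longleftrightarrow> (\<forall>X \<in> pieces M. reduction X \<in> P)"

definition puzzles :: "nat \<Rightarrow> nat mat set \<Rightarrow> nat mat set" where
  "puzzles n P = {M. standard_puzzle n M \<and> is_support P M}"

definition num_puzzles :: "nat \<Rightarrow> nat mat set \<Rightarrow> nat" where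
  "num_puzzles n P = card (puzzles n P)"

definition A2 :: "nat mat" where
  "A2 = mat_of_rows_list 2 [[3, 4],
                            [1, 2]]"

definition B1 :: "nat mat" where
  "B1 = mat_of_rows_list 2 [[4, 2],
                            [1, 3]]"

definition B2 :: "nat mat" where
  "B2 = mat_of_rows_list 2 [[3, 2],
                            [1, 4]]"

definition B3 :: "nat mat" where
  "B3 = mat_of_rows_list 2 [[2, 3],
                            [1, 4]]"

definition B4 :: "nat mat" where
  "B4 = mat_of_rows_list 2 [[3, 1],
                            [2, 4]]"

definition B5 :: "nat mat" where
  "B5 = mat_of_rows_list 2 [[4, 1],
                            [2, 3]]"

definition B6 :: "nat mat" where
  "B6 = mat_of_rows_list 2 [[4, 1],
                            [3, 2]]"

text \<open>The index is shifted by one relative to the usual Catalan numbers.\<close>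

definition shifted_catalan :: "nat \<Rightarrow> real" where
  "shifted_catalan m = 1 / (real m + 2) * real ((2 * m + 2) choose (m + 1))"

text \<open>Catalan's triangle, OEIS A009766; only meant for \<open>k \<le> n\<close>.\<close>

definition catalan_triangle :: "nat \<Rightarrow> nat \<Rightarrow> real" where
  "catalan_triangle n k = (real n - real k + 1) / (real n + 1) * real ((n + k) choose n)"

lemma finite_elements_mat: "finite (elements_mat M)"
proof -
  have "elements_mat M = (\<lambda>(i, j). M $$ (i, j)) ` ({0..<dim_row M} \<times> {0..<dim_col M})"
    unfolding elements_mat_def by force
  then show ?thesis by simp
qed

lemma reduction_less_iff:
  assumes "i < dim_row M" "j < dim_col M" "i' < dim_row M" "j' < dim_col M"
  shows "reduction M $$ (i, j) < reduction M $$ (i', j') \<longleftrightarrow> M $$ (i, j) < M $$ (i', j')"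
proof -
  let ?r = "\<lambda>x. card {y \<in> elements_mat M. y \<le> x}"
  have strict: "?r x < ?r z" if "x < z" "z \<in> elements_mat M" for x z
  proof (rule psubset_card_mono)
    show "finite {y \<in> elements_mat M. y \<le> z}"
      using finite_elements_mat by simp
    have sub: "{y \<in> elements_mat M. y \<le> x} \<subseteq> {y \<in> elements_mat M. y \<le> z}"
      using that(1) by auto
    have z: "z \<in> {y \<in> elements_mat M. y \<le> z}" "z \<notin> {y \<in> elements_mat M. y \<le> x}"
      using that by auto
    show "{y \<in> elements_mat M. y \<le> x} \<subset> {y \<in> elements_mat M. y \<le> z}"
      by (rule psubsetI[OF sub]) (use z in metis)
  qed
  have "M $$ (i, j) \<in> elements_mat M" "M $$ (i', j') \<in> elements_mat M"
    using assms by auto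
  then have "?r (M $$ (i, j)) < ?r (M $$ (i', j')) \<longleftrightarrow> M $$ (i, j) < M $$ (i', j')"
    using strict[of "M $$ (i, j)" "M $$ (i', j')"] strict[of "M $$ (i', j')" "M $$ (i, j)"]
    by (cases "M $$ (i, j)" "M $$ (i', j')" rule: linorder_cases) simp_all
  then show ?thesis
    using assms unfolding reduction_def by simp
qed

lemma reduction_standard_piece:
  assumes M: "M \<in> carrier_mat 2 2"
    and inj: "inj_on (\<lambda>(i, j). M $$ (i, j)) ({0..<2} \<times> {0..<2})"
  shows "standard_piece (reduction M)"
proof -
  let ?I = "{0..<2} \<times> {0..<2} :: (nat \<times> nat) set"
  let ?f = "\<lambda>(i, j). M $$ (i, j)"
  let ?g = "\<lambda>(i, j). reduction M $$ (i, j)"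
  have E: "elements_mat M = ?f ` ?I"
    using M unfolding elements_mat_def by force
  have cardE: "card (elements_mat M) = 4"
    unfolding E card_image[OF inj] by simp
  have g_inj: "inj_on ?g ?I"
  proof (rule inj_onI)
    fix p q assume pq: "p \<in> ?I" "q \<in> ?I" "?g p = ?g q"
    then have "?f p = ?f q"
      using M reduction_less_iff[of "fst p" M "snd p" "fst q" "snd q"]
        reduction_less_iff[of "fst q" M "snd q" "fst p" "snd p"]
      by (auto simp: case_prod_beta)
    then show "p = q" using inj pq by (auto dest: inj_onD)
  qed
  have "?g ` ?I \<subseteq> {1..4}"
  proof
    fix x assume "x \<in> ?g ` ?I"
    then obtain i j where ij: "i < 2" "j < 2" "x = reduction M $$ (i, j)" by auto
    have e: "M $$ (i, j) \<in> elements_mat M" using M ij by auto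
    have x: "x = card {y \<in> elements_mat M. y \<le> M $$ (i, j)}"
      using M ij unfolding reduction_def by simp
    have "x \<le> 4" unfolding x cardE[symmetric]
      by (rule card_mono) (auto simp: finite_elements_mat)
    moreover have "x \<noteq> 0" unfolding x using e finite_elements_mat[of M] by auto
    ultimately show "x \<in> {1..4}" by simp
  qed
  moreover have "card (?g ` ?I) = card {1..4::nat}"
    unfolding card_image[OF g_inj] by simp
  ultimately have "?g ` ?I = {1..4}"
    by (intro card_subset_eq) auto
  then have "bij_betw ?g ?I {1..2 * 2}"
    using g_inj by (simp add: bij_betw_def)
  moreover have "reduction M \<in> carrier_mat 2 2"
    using M unfolding reduction_def by simp
  ultimately show ?thesis
    unfolding standard_piece_def standard_matrix_def by blast
qed

end

theory Submission
  imports Defs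
begin

text \<open>In every \<open>B\<close>-piece the first column decreases downwards and the second increases, whereas both
  columns of \<open>A2\<close> decrease; hence a \<open>B\<close>-piece can only be the last piece. A puzzle is determined by
  its last column \<open>(x, y)\<close> and the standardisation of the other columns. In an \<open>A2\<close>-puzzle the last
  top entry is the maximum, so the number of ways to append a column depends only on the last bottom
  entry, whose distribution is a row of Catalan's triangle: appending \<open>A2\<close> replaces this row by its
  partial sums. The closed forms follow because iterated partial sums of a row are again entries of
  the triangle.\<close>

section \<open>Catalan's triangle\<close>

lemma catalan_triangle_0: "catalan_triangle n 0 = 1"
  by (simp add: catalan_triangle_def)

text \<open>Absorption relates the two binomials, so vertically adjacent entries have a rational
  ratio; \<open>k <= n\<close> keeps the factor \<open>n - k + 1\<close> in the denominator nonzero.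
  Closed forms can thus climb a column starting from the diagonal.\<close>

lemma catalan_triangle_Suc_left:
  assumes "k \<le> n"
  shows "catalan_triangle (Suc n) k =
    catalan_triangle n k * ((real n - real k + 2) * (real n + real k + 1)) / ((real n - real k + 1) * (real n + 2))"
proof -
  have "Suc n * (Suc (n + k) choose Suc n) = Suc (n + k) * (n + k choose n)"
    using Suc_times_binomial_eq[of "n + k" n] by (simp only: mult.commute)
  then have "real (Suc n * ((Suc n + k) choose Suc n)) = real (Suc (n + k) * ((n + k) choose n))"
    by (metis add_Suc)
  then have "real ((Suc n + k) choose Suc n) = (real n + real k + 1) * real ((n + k) choose n) / (real n + 1)"
    by (simp add: field_simps del: binomial_Suc_Suc)
  then have *: "catalan_triangle (Suc n) k =
      (real n - real k + 2) / (real n + 2) * ((real n + real k + 1) * real ((n + k) choose n) / (real n + 1))"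
    by (simp add: catalan_triangle_def ac_simps)
  show ?thesis
    unfolding * unfolding catalan_triangle_def using assms by (simp add: divide_simps)
qed

text \<open>After Pascal's rule only \<open>a\<close> and \<open>b\<close> remain, and absorption
  makes \<open>b\<close> a rational multiple of \<open>a\<close>. The formula gives 0 at
  \<open>k = n + 1\<close>, so the recurrence also covers the edge of the triangle.\<close>

lemma catalan_triangle_rec:
  "catalan_triangle (Suc n) (Suc k) = catalan_triangle (Suc n) k + catalan_triangle n (Suc k)"
proof -
  define a where "a = real ((n + Suc k) choose n)"
  define b where "b = real ((n + Suc k) choose Suc n)"
  have "Suc n * ((n + Suc k) choose Suc n) = Suc k * ((n + Suc k) choose n)"
    using binomial_absorb_comp[of "n + Suc k" n] binomial_absorption[of n "n + Suc k"]
    by (simp del: binomial_Suc_Suc mult_Suc)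
  then have "real (Suc n * ((n + Suc k) choose Suc n)) = real (Suc k * ((n + Suc k) choose n))"
    by (rule arg_cong)
  then have b: "b = (real k + 1) * a / (real n + 1)"
    unfolding a_def b_def by (simp add: field_simps del: binomial_Suc_Suc)
  have *: "catalan_triangle (Suc n) (Suc k) = (real n - real k + 1) / (real n + 2) * (a + b)"
    "catalan_triangle (Suc n) k = (real n - real k + 2) / (real n + 2) * b"
    "catalan_triangle n (Suc k) = (real n - real k) / (real n + 1) * a"
    by (simp_all add: catalan_triangle_def a_def b_def ac_simps)
  show ?thesis unfolding * b by (simp add: divide_simps) (simp add: algebra_simps)
qed

lemma sum_catalan_triangle:
  "(\<Sum>j\<le>k. catalan_triangle n j) = catalan_triangle (Suc n) k"
  by (induction k) (simp_all add: catalan_triangle_rec catalan_triangle_0)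

section \<open>Iterated partial sums and weighted row sums in closed form\<close>

lemma sum_partial_sums:
  fixes f :: "nat \<Rightarrow> real"
  shows "(\<Sum>j\<le>m. (real m - real j + 1) * f j) = (\<Sum>k\<le>m. \<Sum>j\<le>k. f j)"
proof (induction m)
  case (Suc m)
  have "(\<Sum>j\<le>m. (real (Suc m) - real j + 1) * f j) = (\<Sum>j\<le>m. (real m - real j + 1) * f j) + (\<Sum>j\<le>m. f j)"
    by (simp add: sum.distrib[symmetric] algebra_simps)
  with Suc show ?case by simp
qed simp

text \<open>The value \<open>f j\<close> is counted once for each pair \<open>i\<close>,
  \<open>k\<close> with \<open>j <= i <= k <= m\<close>, and there are
  \<open>(m - j + 2) choose 2\<close> such pairs.\<close>

lemma sum_partial_sums2:
  fixes f :: "nat \<Rightarrow> real"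
  shows "(\<Sum>j\<le>m. (real m - real j + 1) * (real m - real j + 2) / 2 * f j) =
    (\<Sum>k\<le>m. \<Sum>i\<le>k. \<Sum>j\<le>i. f j)"
proof (induction m)
  case (Suc m)
  have "(\<Sum>j\<le>m. (real (Suc m) - real j + 1) * (real (Suc m) - real j + 2) / 2 * f j) =
      (\<Sum>j\<le>m. (real m - real j + 1) * (real m - real j + 2) / 2 * f j) +
      (\<Sum>j\<le>m. (real m - real j + 1) * f j) + (\<Sum>j\<le>m. f j)"
    unfolding sum.distrib[symmetric] by (rule sum.cong) (auto simp: field_simps)
  with Suc show ?case by (simp add: sum_partial_sums)
qed simp

text \<open>One, two or three rounds of partial sums of row \<open>m\<close> lead to the entries of
  column \<open>m\<close> in rows \<open>m + 1\<close>, \<open>m + 2\<close>, \<open>m + 3\<close>.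
  Each of these follows from the diagonal entry by the ratio of vertical neighbours. The three
  weights span the polynomials of degree at most 2 in \<open>j\<close>, which suffices for all six
  counts.\<close>

lemma sum_catalan_triangle_weighted:
  fixes m :: nat
  defines "D \<equiv> real ((2 * m) choose m)"
  shows "(\<Sum>j\<le>m. catalan_triangle m j) = 2 * (2 * real m + 1) / ((real m + 1) * (real m + 2)) * D"
    "(\<Sum>j\<le>m. (real m - real j + 1) * catalan_triangle m j) = 6 * (2 * real m + 1) / ((real m + 2) * (real m + 3)) * D"
    "(\<Sum>j\<le>m. (real m - real j + 1) * (real m - real j + 2) / 2 * catalan_triangle m j) =
       8 * (2 * real m + 1) * (2 * real m + 3) / ((real m + 2) * (real m + 3) * (real m + 4)) * D"
proof -
  have t: "catalan_triangle m m = D / (real m + 1)"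
    by (simp add: catalan_triangle_def D_def mult_2)
  have t1: "catalan_triangle (Suc m) m = 2 * (2 * real m + 1) / ((real m + 1) * (real m + 2)) * D"
    by (subst catalan_triangle_Suc_left) (simp_all add: t divide_simps, (simp add: algebra_simps)?)
  have t2: "catalan_triangle (Suc (Suc m)) m = 6 * (2 * real m + 1) / ((real m + 2) * (real m + 3)) * D"
    by (subst catalan_triangle_Suc_left) (simp_all add: t1 divide_simps, (simp add: algebra_simps)?)
  have t3: "catalan_triangle (Suc (Suc (Suc m))) m =
      8 * (2 * real m + 1) * (2 * real m + 3) / ((real m + 2) * (real m + 3) * (real m + 4)) * D"
    by (subst catalan_triangle_Suc_left) (simp_all add: t2 divide_simps, (simp add: algebra_simps)?)
  show "(\<Sum>j\<le>m. catalan_triangle m j) = 2 * (2 * real m + 1) / ((real m + 1) * (real m + 2)) * D"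
    by (simp add: sum_catalan_triangle t1)
  show "(\<Sum>j\<le>m. (real m - real j + 1) * catalan_triangle m j) = 6 * (2 * real m + 1) / ((real m + 2) * (real m + 3)) * D"
    by (simp add: sum_partial_sums sum_catalan_triangle t2)
  show "(\<Sum>j\<le>m. (real m - real j + 1) * (real m - real j + 2) / 2 * catalan_triangle m j) =
       8 * (2 * real m + 1) * (2 * real m + 3) / ((real m + 2) * (real m + 3) * (real m + 4)) * D"
    by (simp only: sum_partial_sums2 sum_catalan_triangle t3)
qed

lemma real_choose_2: "real (k choose 2) = real k * (real k - 1) / 2"
  by (cases k) (auto simp: choose_two real_of_nat_div algebra_simps)

lemma central_binomial_Suc:
  "real ((2 * Suc m) choose Suc m) = 2 * (2 * real m + 1) / (real m + 1) * real ((2 * m) choose m)"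
proof -
  have "fact (2 * Suc m) = (2 * real m + 2) * ((2 * real m + 1) * fact (2 * m))"
    by (simp add: algebra_simps)
  then have 1: "real ((2 * Suc m) choose Suc m) =
      (2 * real m + 2) * ((2 * real m + 1) * fact (2 * m)) / (((real m + 1) * fact m) * ((real m + 1) * fact m))"
    by (subst binomial_fact) (simp_all add: add.commute)
  have 2: "real ((2 * m) choose m) = fact (2 * m) / (fact m * fact m)"
    by (subst binomial_fact) simp_all
  show ?thesis
    unfolding 1 2 by (simp add: divide_simps) (simp add: algebra_simps)
qed

text \<open>Absorption compares the binomial with its right neighbour, which is half of the central
  one. This expresses the closed form for \<open>B6\<close> in central binomials like the
  others.\<close>

lemma choose_below_central:
  assumes "0 < n"
  shows "real ((2 * n + 1) choose (n - 1)) = real n / (2 * (real n + 2)) * real ((2 * n + 2) choose (n + 1))"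
proof -
  define A where "A = (2 * n + 1) choose (n - 1)"
  define B where "B = (2 * n + 1) choose n"
  have e: "(2 * n + 2) choose (n + 1) = 2 * B"
    using binomial_symmetric[of n "2 * n + 1"] by (simp add: B_def)
  have "(2 * n + 1 - (n - 1)) * A = n * B"
    using binomial_absorb_comp[of "2 * n + 1" "n - 1"] binomial_absorption[of "n - 1" "2 * n + 1"] assms
    by (simp only: A_def B_def) simp
  moreover have "2 * n + 1 - (n - 1) = n + 2" using assms by simp
  ultimately have "real (n + 2) * real A = real n * real B"
    by (metis of_nat_mult)
  then show ?thesis
    unfolding e A_def[symmetric] by (simp add: field_simps)
qed

text \<open>With \<open>n = m + 2\<close> and \<open>k = j + 1\<close> every weight is a polynomial
  of degree at most 2 in \<open>u j = m - j + 1\<close>. Expanding it in \<open>1\<close>,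
  \<open>u\<close>, \<open>u * (u + 1) / 2\<close> turns each claim into an identity of rational
  functions of \<open>x = m\<close>, multiplied by the central binomial \<open>D\<close>.\<close>

lemma sum_catalan_triangle_closed_forms:
  assumes "2 \<le> n"
  defines "S \<equiv> \<lambda>w :: nat \<Rightarrow> real. (\<Sum>k = 1..n - 1. w k * catalan_triangle (n - 2) (k - 1))"
  shows
    "S (\<lambda>k. real ((n - k + 2) choose 2)) + shifted_catalan (n - 1)
        = 1 / (real n + 2) * real ((2 * n + 2) choose (n + 1))" (is ?B1)
    "S (\<lambda>k. real n - real k + 1) + shifted_catalan (n - 1)
        = 2 / (real n + 1) * real ((2 * n) choose n)" (is ?B2)
    "S (\<lambda>k. 1) = shifted_catalan (n - 2)" (is ?B3)
    "S (\<lambda>k. real n + real k - 1) + shifted_catalan (n - 1)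
        = 2 * real ((2 * n - 2) choose (n - 1))" (is ?B4)
    "S (\<lambda>k. (real n + real k - 1) * (real n - real k + 1)) + shifted_catalan (n - 1)
        = (2 * real n ^ 2 + 4) / ((real n + 1) * (real n + 2)) * real ((2 * n) choose n)" (is ?B5)
    "S (\<lambda>k. real ((n + k) choose 2)) + shifted_catalan (n - 1)
        = (real n ^ 2 - real n + 4) / (4 * real n - 2) * real ((2 * n + 1) choose (n - 1))" (is ?B6)
proof -
  define m where "m = n - 2"
  have n: "n = m + 2" using assms by (simp add: m_def)
  define D where "D = real ((2 * m) choose m)"
  define x where "x = real m"
  define u where "u = (\<lambda>j. x - real j + 1)"
  have x0: "x \<ge> 0" by (simp add: x_def)
  have rn: "real n = x + 2" by (simp add: n x_def)
  \<comment> \<open>The sum is linear in the weight, so the coefficients \<open>a\<close>,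
    \<open>b\<close>, \<open>c\<close> of the expansion determine its value.\<close>
  have lin: "S w = a * (2 * (2 * x + 1) / ((x + 1) * (x + 2)) * D) +
      b * (6 * (2 * x + 1) / ((x + 2) * (x + 3)) * D) +
      c * (8 * (2 * x + 1) * (2 * x + 3) / ((x + 2) * (x + 3) * (x + 4)) * D)"
    if "\<And>j. j \<le> m \<Longrightarrow> w (Suc j) = a + b * u j + c * (u j * (u j + 1) / 2)" for w a b c
  proof -
    have "{1..n - 1} = {1..Suc m}" by (simp add: n)
    then have "S w = (\<Sum>j\<le>m. w (Suc j) * catalan_triangle m j)"
      unfolding S_def by (simp only: One_nat_def sum.atLeast1_atMost_eq lessThan_Suc_atMost) (simp add: n)
    also have "\<dots> = (\<Sum>j\<le>m. a * catalan_triangle m j + b * ((real m - real j + 1) * catalan_triangle m j)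
        + c * ((real m - real j + 1) * (real m - real j + 2) / 2 * catalan_triangle m j))"
      by (rule sum.cong) (simp_all add: that u_def x_def algebra_simps)
    finally show ?thesis
      unfolding sum.distrib sum_distrib_left[symmetric] sum_catalan_triangle_weighted D_def x_def .
  qed
  have D1: "real ((2 * m + 2) choose (m + 1)) = 2 * (2 * x + 1) / (x + 1) * D"
    using central_binomial_Suc[of m] by (simp add: x_def D_def)
  \<comment> \<open>The next central binomials are reached from \<open>D\<close> by repeated use of
    \<open>central_binomial_Suc\<close>; these equations normalise its instances at
    \<open>m + 1\<close> and \<open>m + 2\<close>.\<close>
  have E: "2 * Suc (m + 1) = 2 * m + 4" "Suc (m + 1) = m + 2" "2 * (m + 1) = 2 * m + 2"
    "2 * Suc (m + 2) = 2 * m + 6" "Suc (m + 2) = m + 3" "2 * (m + 2) = 2 * m + 4"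
    "2 * real (m + 1) + 1 = 2 * x + 3" "real (m + 1) + 1 = x + 2"
    "2 * real (m + 2) + 1 = 2 * x + 5" "real (m + 2) + 1 = x + 3"
    by (simp_all add: x_def)
  have D2: "real ((2 * m + 4) choose (m + 2)) = 2 * (2 * x + 3) / (x + 2) * (2 * (2 * x + 1) / (x + 1) * D)"
    using central_binomial_Suc[of "m + 1", unfolded E] D1 by simp
  have D3: "real ((2 * m + 6) choose (m + 3)) =
      2 * (2 * x + 5) / (x + 3) * (2 * (2 * x + 3) / (x + 2) * (2 * (2 * x + 1) / (x + 1) * D))"
    using central_binomial_Suc[of "m + 2", unfolded E] D2 by simp
  have C0: "shifted_catalan (n - 2) = 2 * (2 * x + 1) / ((x + 1) * (x + 2)) * D"
    using D1 by (simp add: shifted_catalan_def n x_def)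
  have E': "2 * (n - 1) + 2 = 2 * m + 4" "n - 1 + 1 = m + 2" "real (n - 1) + 2 = x + 3"
    by (simp_all add: n x_def)
  have C1: "shifted_catalan (n - 1) = 1 / (x + 3) * (2 * (2 * x + 3) / (x + 2) * (2 * (2 * x + 1) / (x + 1) * D))"
    unfolding shifted_catalan_def E' D2 ..
  have N: "2 * n + 2 = 2 * m + 6" "n + 1 = m + 3"
    by (simp_all add: n)
  note e1 = D3[folded N]
  have N': "2 * n = 2 * m + 4"
    by (simp add: n)
  note e2 = D2[folded N' n]
  have B1: "S (\<lambda>k. real ((n - k + 2) choose 2)) = 1 * (2 * (2 * x + 1) / ((x + 1) * (x + 2)) * D) +
      1 * (6 * (2 * x + 1) / ((x + 2) * (x + 3)) * D) +
      1 * (8 * (2 * x + 1) * (2 * x + 3) / ((x + 2) * (x + 3) * (x + 4)) * D)"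
    by (rule lin) (simp add: real_choose_2 u_def x_def n field_simps)
  show ?B1
    unfolding B1 unfolding C1 e1 rn using x0 by (simp add: divide_simps) (simp add: algebra_simps)
  have B2: "S (\<lambda>k. real n - real k + 1) = 1 * (2 * (2 * x + 1) / ((x + 1) * (x + 2)) * D) +
      1 * (6 * (2 * x + 1) / ((x + 2) * (x + 3)) * D) +
      0 * (8 * (2 * x + 1) * (2 * x + 3) / ((x + 2) * (x + 3) * (x + 4)) * D)"
    by (rule lin) (simp add: u_def x_def n field_simps)
  show ?B2
    unfolding B2 unfolding C1 e2 rn using x0 by (simp add: divide_simps) (simp add: algebra_simps)
  have B3: "S (\<lambda>k. 1) = 1 * (2 * (2 * x + 1) / ((x + 1) * (x + 2)) * D) +
      0 * (6 * (2 * x + 1) / ((x + 2) * (x + 3)) * D) +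
      0 * (8 * (2 * x + 1) * (2 * x + 3) / ((x + 2) * (x + 3) * (x + 4)) * D)"
    by (rule lin) simp
  show ?B3
    unfolding B3 C0 by simp
  have B4: "S (\<lambda>k. real n + real k - 1) = (2 * x + 3) * (2 * (2 * x + 1) / ((x + 1) * (x + 2)) * D) +
      (- 1) * (6 * (2 * x + 1) / ((x + 2) * (x + 3)) * D) +
      0 * (8 * (2 * x + 1) * (2 * x + 3) / ((x + 2) * (x + 3) * (x + 4)) * D)"
    by (rule lin) (simp add: u_def x_def n field_simps)
  have e4: "real ((2 * n - 2) choose (n - 1)) = 2 * (2 * x + 1) / (x + 1) * D"
    using D1 by (simp add: n)
  show ?B4
    unfolding B4 unfolding C1 e4 using x0 by (simp add: divide_simps) (simp add: algebra_simps)
  \<comment> \<open>Here \<open>n + k - 1 = 2 * x + 3 - u\<close> and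
    \<open>n - k + 1 = u + 1\<close>; the product is
    \<open>(2 * x + 3) * (1 + u) - u * (u + 1)\<close>, hence the coefficient -2.\<close>
  have B5: "S (\<lambda>k. (real n + real k - 1) * (real n - real k + 1)) =
      (2 * x + 3) * (2 * (2 * x + 1) / ((x + 1) * (x + 2)) * D) +
      (2 * x + 3) * (6 * (2 * x + 1) / ((x + 2) * (x + 3)) * D) +
      (- 2) * (8 * (2 * x + 1) * (2 * x + 3) / ((x + 2) * (x + 3) * (x + 4)) * D)"
    by (rule lin) (simp add: u_def x_def n field_simps)
  show ?B5
    unfolding B5 unfolding C1 e2 rn using x0 by (simp add: divide_simps) (simp add: algebra_simps power2_eq_square)
  \<comment> \<open>Here \<open>n + k = N - u\<close> with \<open>N = 2 * x + 4\<close>, and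
    choosing 2 from it gives \<open>N * (N - 1) / 2 - N * u + u * (u + 1) / 2\<close>.\<close>
  have B6: "S (\<lambda>k. real ((n + k) choose 2)) =
      ((2 * x + 4) * (2 * x + 3) / 2) * (2 * (2 * x + 1) / ((x + 1) * (x + 2)) * D) +
      (- (2 * x + 4)) * (6 * (2 * x + 1) / ((x + 2) * (x + 3)) * D) +
      1 * (8 * (2 * x + 1) * (2 * x + 3) / ((x + 2) * (x + 3) * (x + 4)) * D)"
    by (rule lin) (simp add: real_choose_2 u_def x_def n field_simps)
  have "0 < n" by (simp add: n)
  note c = choose_below_central[OF this]
  show ?B6
    unfolding B6 unfolding C1 c e1 rn using x0
    by (simp add: divide_simps) (simp add: algebra_simps power2_eq_square)
qed

section \<open>Appending a column\<close>

text \<open>An injection between finite sets of the same size \<open>2 * c\<close> is onto, so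
  surjectivity need not be checked separately.\<close>

lemma standard_matrix_iff:
  "standard_matrix c M \<longleftrightarrow> M \<in> carrier_mat 2 c \<and>
     inj_on (\<lambda>(i, j). M $$ (i, j)) ({0..<2} \<times> {0..<c}) \<and>
     (\<forall>i<2. \<forall>j<c. M $$ (i, j) \<in> {1..2 * c})"
proof -
  let ?f = "\<lambda>(i, j). M $$ (i, j)" and ?I = "{0..<2} \<times> {0..<c} :: (nat \<times> nat) set"
  have "?f ` ?I = {1..2 * c}" if "inj_on ?f ?I" "?f ` ?I \<subseteq> {1..2 * c}"
    using that by (intro card_subset_eq) (simp_all add: card_image)
  moreover have "?f ` ?I \<subseteq> {1..2 * c} \<longleftrightarrow> (\<forall>i<2. \<forall>j<c. M $$ (i, j) \<in> {1..2 * c})"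
    by (auto simp: image_subset_iff)
  ultimately show ?thesis
    unfolding standard_matrix_def bij_betw_def by blast
qed

section \<open>Reductions as order patterns\<close>

lemma reduction_index:
  assumes "inj_on (\<lambda>(i, j). M $$ (i, j)) ({0..<dim_row M} \<times> {0..<dim_col M})"
    and "i < dim_row M" "j < dim_col M"
  shows "reduction M $$ (i, j) =
    card {(i', j') \<in> {0..<dim_row M} \<times> {0..<dim_col M}. M $$ (i', j') \<le> M $$ (i, j)}"
proof -
  let ?f = "\<lambda>(i, j). M $$ (i, j)"
  let ?J = "{(i', j') \<in> {0..<dim_row M} \<times> {0..<dim_col M}. M $$ (i', j') \<le> M $$ (i, j)}"
  have "{y \<in> elements_mat M. y \<le> M $$ (i, j)} = ?f ` ?J"
    unfolding elements_mat_def by force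
  moreover have "inj_on ?f ?J"
    using assms(1) by (rule inj_on_subset) auto
  ultimately show ?thesis
    using assms(2,3) by (simp add: reduction_def card_image)
qed

text \<open>With distinct entries a rank is a number of positions, and this number depends only on
  the comparisons between positions.\<close>

lemma reduction_cong:
  assumes "M \<in> carrier_mat r c" "N \<in> carrier_mat r c"
    and "inj_on (\<lambda>(i, j). M $$ (i, j)) ({0..<r} \<times> {0..<c})"
    and "inj_on (\<lambda>(i, j). N $$ (i, j)) ({0..<r} \<times> {0..<c})"
    and le: "\<And>i j i' j'. i < r \<Longrightarrow> j < c \<Longrightarrow> i' < r \<Longrightarrow> j' < c \<Longrightarrow>
      M $$ (i, j) \<le> M $$ (i', j') \<longleftrightarrow> N $$ (i, j) \<le> N $$ (i', j')"
  shows "reduction M = reduction N"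
proof (rule eq_matI)
  fix i j assume "i < dim_row (reduction N)" "j < dim_col (reduction N)"
  then have ij: "i < r" "j < c" using assms by (simp_all add: reduction_def)
  have "{(i', j') \<in> {0..<r} \<times> {0..<c}. M $$ (i', j') \<le> M $$ (i, j)} =
      {(i', j') \<in> {0..<r} \<times> {0..<c}. N $$ (i', j') \<le> N $$ (i, j)}"
    using le ij by auto
  then show "reduction M $$ (i, j) = reduction N $$ (i, j)"
    using assms ij reduction_index[of M i j] reduction_index[of N i j] by simp
qed (use assms in \<open>simp_all add: reduction_def\<close>)

lemma reduction_id:
  assumes "standard_matrix c M"
  shows "reduction M = M"
proof -
  have M: "M \<in> carrier_mat 2 c" using assms by (simp add: standard_matrix_def)
  have "elements_mat M = (\<lambda>(i, j). M $$ (i, j)) ` ({0..<2} \<times> {0..<c})"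
    using M unfolding elements_mat_def by force
  then have E: "elements_mat M = {1..2 * c}"
    using assms by (simp add: standard_matrix_def bij_betw_def)
  have "card {y \<in> {1..2 * c}. y \<le> x} = x" if "x \<in> {1..2 * c}" for x
  proof -
    have "{y \<in> {1..2 * c}. y \<le> x} = {1..x}" using that by auto
    then show ?thesis by simp
  qed
  then have "card {y \<in> {1..2 * c}. y \<le> M $$ (i, j)} = M $$ (i, j)" if "i < 2" "j < c" for i j
    using assms that unfolding standard_matrix_iff by blast
  then show ?thesis
    unfolding reduction_def E using M by (intro eq_matI) (auto simp del: atLeastAtMost_iff)
qed

text \<open>A standard piece is its own reduction, so having it as reduction means exactly having
  its order pattern.\<close>

lemma reduction_eq_iff:
  assumes "standard_piece Q" "M \<in> carrier_mat 2 2"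
    and inj: "inj_on (\<lambda>(i, j). M $$ (i, j)) ({0..<2} \<times> {0..<2})"
  shows "reduction M = Q \<longleftrightarrow> (\<forall>i<2. \<forall>j<2. \<forall>i'<2. \<forall>j'<2.
    M $$ (i, j) \<le> M $$ (i', j') \<longleftrightarrow> Q $$ (i, j) \<le> Q $$ (i', j'))" (is "_ \<longleftrightarrow> ?R")
proof
  assume Q: "reduction M = Q"
  show ?R
  proof (intro allI impI)
    fix i j i' j' :: nat assume "i < 2" "j < 2" "i' < 2" "j' < 2"
    then show "M $$ (i, j) \<le> M $$ (i', j') \<longleftrightarrow> Q $$ (i, j) \<le> Q $$ (i', j')"
      using reduction_less_iff[of i' M j' i j] assms(2) unfolding Q[symmetric]
      by (metis carrier_matD linorder_not_less)
  qed
next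
  assume ?R
  moreover have Q: "standard_matrix 2 Q" using assms(1) by (simp add: standard_piece_def)
  ultimately have "reduction M = reduction Q"
    using assms by (intro reduction_cong) (auto simp: standard_matrix_iff)
  then show "reduction M = Q" using reduction_id[OF Q] by simp
qed

section \<open>Standard matrices as a smaller standard matrix with a last column\<close>

text \<open>For distinct \<open>x, y > 0\<close>, the increasing bijection from the positive integers to those other than
  \<open>x\<close> and \<open>y\<close>.\<close>

definition skip2 :: "nat \<Rightarrow> nat \<Rightarrow> nat \<Rightarrow> nat" where
  "skip2 x y v = (if v < min x y then v else if v + 1 < max x y then v + 1 else v + 2)"

lemma strict_mono_skip2: "strict_mono (skip2 x y)"
  by (auto simp: strict_mono_def skip2_def)

lemma skip2_neq: "skip2 x y v \<noteq> x" "skip2 x y v \<noteq> y"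
  by (auto simp: skip2_def)

text \<open>The old entries are lifted past \<open>x\<close> and \<open>y\<close> without changing
  their order, so \<open>M\<close> stays the standardisation of the columns before the last.\<close>

definition append_column :: "nat mat \<Rightarrow> nat \<Rightarrow> nat \<Rightarrow> nat mat" where
  "append_column M x y = mat 2 (dim_col M + 1) (\<lambda>(i, j).
     if j < dim_col M then skip2 x y (M $$ (i, j)) else if i = 0 then x else y)"

definition new_columns :: "nat \<Rightarrow> (nat \<times> nat) set" where
  "new_columns c = {(x, y). x \<in> {1..2 * c + 2} \<and> y \<in> {1..2 * c + 2} \<and> x \<noteq> y}"

lemma append_column_inject:
  assumes "M \<in> carrier_mat 2 c" "M' \<in> carrier_mat 2 c" "append_column M x y = append_column M' x' y'"
  shows "M = M' \<and> x = x' \<and> y = y'"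
proof -
  have eq: "append_column M x y $$ (i, j) = append_column M' x' y' $$ (i, j)" for i j
    using assms(3) by simp
  have xy: "x = x'" "y = y'"
    using eq[of 0 c] eq[of 1 c] assms(1,2) by (simp_all add: append_column_def)
  have "M $$ (i, j) = M' $$ (i, j)" if "i < 2" "j < c" for i j
    using eq[of i j] that assms(1,2) strict_mono_eq[OF strict_mono_skip2]
    by (simp add: append_column_def xy)
  then show ?thesis using xy assms(1,2) by auto
qed

lemma standard_append_column:
  assumes "standard_matrix c M" "(x, y) \<in> new_columns c"
  shows "standard_matrix (c + 1) (append_column M x y)"
proof -
  have M: "M \<in> carrier_mat 2 c" and inj: "inj_on (\<lambda>(i, j). M $$ (i, j)) ({0..<2} \<times> {0..<c})"
    and b: "\<And>i j. i < 2 \<Longrightarrow> j < c \<Longrightarrow> 1 \<le> M $$ (i, j) \<and> M $$ (i, j) \<le> 2 * c"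
    using assms(1) by (auto simp: standard_matrix_iff)
  have xy: "1 \<le> x" "x \<le> 2 * c + 2" "1 \<le> y" "y \<le> 2 * c + 2" "x \<noteq> y"
    using assms(2) by (auto simp: new_columns_def)
  have r: "1 \<le> skip2 x y v \<and> skip2 x y v \<le> 2 * c + 2" if "1 \<le> v \<and> v \<le> 2 * c" for v
    using that by (auto simp: skip2_def)
  have "inj_on (\<lambda>(i, j). append_column M x y $$ (i, j)) ({0..<2} \<times> {0..<c + 1})"
  proof (rule inj_onI, clarsimp)
    fix i j i' j' assume a: "i < (2 :: nat)" "j < Suc c" "i' < (2 :: nat)" "j' < Suc c"
      "append_column M x y $$ (i, j) = append_column M x y $$ (i', j')"
    show "i = i' \<and> j = j'"
    proof (cases "j < c \<and> j' < c")
      case True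
      with a M have "M $$ (i, j) = M $$ (i', j')"
        by (simp add: append_column_def strict_mono_eq[OF strict_mono_skip2])
      with inj True a(1,3) show ?thesis by (auto dest: inj_onD)
    next
      \<comment> \<open>At least one of the positions lies in the new column. Its entries are
        distinct and avoided by \<open>skip2\<close>, so equal values force equal positions.\<close>
      case False
      with a M xy skip2_neq[of x y] skip2_neq[of x y, symmetric] show ?thesis
        by (auto simp: append_column_def less_Suc_eq numeral_2_eq_2 split: if_splits)
    qed
  qed
  then show ?thesis
    using M b r xy by (auto simp: standard_matrix_iff append_column_def)
qed

text \<open>The preimage is \<open>w\<close> lowered by the number of those among \<open>x\<close>
  and \<open>y\<close> that lie below it.\<close>

lemma skip2_surj:
  assumes "w \<noteq> x" "w \<noteq> y" "x \<noteq> y"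
  shows "\<exists>v. skip2 x y v = w"
proof -
  have "skip2 x y w = w" if "w < min x y"
    using that by (auto simp: skip2_def)
  moreover have "skip2 x y (w - 1) = w" if "min x y < w" "w < max x y"
    using that by (auto simp: skip2_def)
  moreover have "skip2 x y (w - 2) = w" if "max x y < w"
    using that assms(3) by (auto simp: skip2_def)
  ultimately show ?thesis
    using assms by (metis linorder_neqE_nat max_def min_def)
qed

lemma append_column_surj:
  assumes "standard_matrix (c + 1) N"
  obtains M x y where "standard_matrix c M" "(x, y) \<in> new_columns c" "N = append_column M x y"
proof -
  define x where "x = N $$ (0, c)"
  define y where "y = N $$ (1, c)"
  have N: "N \<in> carrier_mat 2 (c + 1)"
    and inj: "inj_on (\<lambda>(i, j). N $$ (i, j)) ({0..<2} \<times> {0..<c + 1})"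
    and b: "\<And>i j. i < 2 \<Longrightarrow> j < c + 1 \<Longrightarrow> 1 \<le> N $$ (i, j) \<and> N $$ (i, j) \<le> 2 * c + 2"
    using assms by (auto simp: standard_matrix_iff)
  have injD: "i = i' \<and> j = j'" if "N $$ (i, j) = N $$ (i', j')" "i < 2" "i' < 2" "j < c + 1" "j' < c + 1" for i j i' j'
    using inj_onD[OF inj, of "(i, j)" "(i', j')"] that by simp
  have xy: "(x, y) \<in> new_columns c" "x \<noteq> y"
    using b[of 0 c] b[of 1 c] injD[of 0 c 1 c] by (auto simp: new_columns_def x_def y_def)
  \<comment> \<open>A choice of preimage under \<open>skip2\<close>. It exists for each entry
    outside the last column, because such an entry differs from \<open>x\<close> and
    \<open>y\<close> by injectivity.\<close>
  define g where "g w = (SOME v. skip2 x y v = w)" for w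
  have g: "skip2 x y (g (N $$ (i, j))) = N $$ (i, j)" if "i < 2" "j < c" for i j
  proof -
    have "N $$ (i, j) \<noteq> x" "N $$ (i, j) \<noteq> y"
      using injD[of i j 0 c] injD[of i j 1 c] that by (auto simp: x_def y_def)
    then have "\<exists>v. skip2 x y v = N $$ (i, j)"
      using skip2_surj xy(2) by simp
    then show ?thesis
      unfolding g_def by (rule someI_ex)
  qed
  define M where "M = mat 2 c (\<lambda>(i, j). g (N $$ (i, j)))"
  have "inj_on (\<lambda>(i, j). M $$ (i, j)) ({0..<2} \<times> {0..<c})"
  proof (rule inj_onI, clarsimp)
    fix i j i' j' assume a: "i < (2 :: nat)" "j < c" "i' < (2 :: nat)" "j' < c" "M $$ (i, j) = M $$ (i', j')"
    then have "g (N $$ (i, j)) = g (N $$ (i', j'))"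
      by (simp add: M_def)
    then have "N $$ (i, j) = N $$ (i', j')"
      using g[OF a(1,2)] g[OF a(3,4)] by argo
    from injD[OF this a(1,3)] show "i = i' \<and> j = j'"
      using a(2,4) by simp
  qed
  moreover have "1 \<le> v \<and> v \<le> 2 * c" if "1 \<le> skip2 x y v" "skip2 x y v \<le> 2 * c + 2" for v
    using that xy by (auto simp: skip2_def new_columns_def split: if_splits)
  then have "M $$ (i, j) \<in> {1..2 * c}" if "i < 2" "j < c" for i j
    using b[of i j] g[of i j] that by (simp add: M_def)
  ultimately have "standard_matrix c M"
    by (simp add: standard_matrix_iff M_def)
  moreover have "N = append_column M x y"
  proof (rule eq_matI)
    fix i j assume "i < dim_row (append_column M x y)" "j < dim_col (append_column M x y)"
    then have "i < 2" "j < c + 1" by (simp_all add: append_column_def M_def)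
    then show "N $$ (i, j) = append_column M x y $$ (i, j)"
      using g[of i j] by (auto simp: append_column_def M_def x_def y_def less_Suc_eq numeral_2_eq_2)
  qed (use N in \<open>simp_all add: append_column_def M_def\<close>)
  ultimately show thesis using that xy(1) by blast
qed

lemma standard_matrix_imp_piece:
  assumes "standard_matrix c M" "p + 1 < c"
  shows "piece M p \<in> carrier_mat 2 2"
    "inj_on (\<lambda>(i, j). piece M p $$ (i, j)) ({0..<2} \<times> {0..<2})"
proof -
  show "inj_on (\<lambda>(i, j). piece M p $$ (i, j)) ({0..<2} \<times> {0..<2})"
  proof (rule inj_onI, clarsimp)
    fix i j i' j' assume "i < (2 :: nat)" "j < (2 :: nat)" "i' < (2 :: nat)" "j' < (2 :: nat)"
      "piece M p $$ (i, j) = piece M p $$ (i', j')"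
    then show "i = i' \<and> j = j'"
      using assms inj_onD[of "\<lambda>(i, j). M $$ (i, j)" "{0..<2} \<times> {0..<c}" "(i, p + j)" "(i', p + j')"]
      by (simp add: standard_matrix_iff piece_def)
  qed
qed (simp add: piece_def)

text \<open>Old pieces keep their order pattern because \<open>skip2\<close> is strictly increasing.
  Only the piece ending in the new column has to be examined.\<close>

lemma reduction_piece_append_column:
  assumes "standard_matrix c M" "(x, y) \<in> new_columns c" "p + 1 < c"
  shows "reduction (piece (append_column M x y) p) = reduction (piece M p)"
proof -
  have M: "M \<in> carrier_mat 2 c" using assms by (simp add: standard_matrix_iff)
  show ?thesis
  proof (rule reduction_cong)
    show "inj_on (\<lambda>(i, j). piece (append_column M x y) p $$ (i, j)) ({0..<2} \<times> {0..<2})"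
      by (rule standard_matrix_imp_piece(2)[OF standard_append_column[OF assms(1,2)]]) (use assms in simp)
    show "inj_on (\<lambda>(i, j). piece M p $$ (i, j)) ({0..<2} \<times> {0..<2})"
      by (rule standard_matrix_imp_piece(2)[OF assms(1,3)])
  qed (use M assms(3) in \<open>simp_all add: piece_def append_column_def strict_mono_less_eq[OF strict_mono_skip2]\<close>)
qed

lemma is_support_iff:
  "M \<in> carrier_mat 2 c \<Longrightarrow> is_support P M \<longleftrightarrow> (\<forall>p. p + 1 < c \<longrightarrow> reduction (piece M p) \<in> P)"
  by (auto simp: is_support_def pieces_def)

text \<open>By induction on the number of columns: each larger matrix comes from a smaller one and
  one of finitely many last columns.\<close>

lemma finite_standard_matrix: "finite {M. standard_matrix c M}"
proof (induction c)
  case 0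
  have "{M. standard_matrix 0 M} \<subseteq> {mat 2 0 (\<lambda>_. 0)}"
    by (auto simp: standard_matrix_def)
  then show ?case by (rule finite_subset) simp
next
  case (Suc c)
  have "finite (new_columns c)"
    by (rule finite_subset[of _ "{1..2 * c + 2} \<times> {1..2 * c + 2}"]) (auto simp: new_columns_def)
  moreover have "{M. standard_matrix (Suc c) M} \<subseteq>
      (\<lambda>(M, x, y). append_column M x y) ` ({M. standard_matrix c M} \<times> new_columns c)"
  proof
    fix N :: "nat mat" assume "N \<in> {M. standard_matrix (Suc c) M}"
    then obtain M x y where "standard_matrix c M" "(x, y) \<in> new_columns c" "N = append_column M x y"
      using append_column_surj[of c N] by auto
    then show "N \<in> (\<lambda>(M, x, y). append_column M x y) ` ({M. standard_matrix c M} \<times> new_columns c)"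
      by (intro image_eqI[of _ _ "(M, x, y)"]) auto
  qed
  ultimately show ?case using Suc by (auto intro: finite_subset)
qed

section \<open>Counting puzzles by the last column\<close>

text \<open>These puzzles have \<open>m + 1\<close> pieces, and \<open>P\<close> constrains only the
  first \<open>m\<close>. Thus \<open>Q\<close> may be a \<open>B\<close>-piece while
  \<open>P\<close> is \<open>{A2}\<close>.\<close>

definition last_piece_puzzles :: "nat \<Rightarrow> nat mat set \<Rightarrow> nat mat \<Rightarrow> nat mat set" where
  "last_piece_puzzles m P Q = {N. standard_matrix (m + 2) N \<and>
     (\<forall>p<m. reduction (piece N p) \<in> P) \<and> reduction (piece N m) = Q}"

definition extensions :: "nat mat \<Rightarrow> nat mat \<Rightarrow> (nat \<times> nat) set" where
  "extensions M Q = {(x, y) \<in> new_columns (dim_col M).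
     reduction (piece (append_column M x y) (dim_col M - 1)) = Q}"

lemma puzzles_iff:
  "M \<in> puzzles m P \<longleftrightarrow> standard_matrix (m + 1) M \<and> (\<forall>p<m. reduction (piece M p) \<in> P)"
  unfolding puzzles_def standard_puzzle_def
  using is_support_iff[of M "m + 1" P] by (auto simp: standard_matrix_def)

lemma finite_puzzles: "finite (puzzles m P)"
  by (rule finite_subset[OF _ finite_standard_matrix[of "m + 1"]]) (auto simp: puzzles_iff)

lemma finite_last_piece_puzzles: "finite (last_piece_puzzles m P Q)"
  by (rule finite_subset[OF _ finite_standard_matrix[of "m + 2"]]) (auto simp: last_piece_puzzles_def)

lemma finite_extensions: "finite (extensions M Q)"
  by (rule finite_subset[of _ "{1..2 * dim_col M + 2} \<times> {1..2 * dim_col M + 2}"])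
    (auto simp: extensions_def new_columns_def)

text \<open>Removing the last column and standardising preserves the first \<open>m\<close>
  reductions; appending an admissible column reverses this.\<close>

lemma last_piece_puzzles_eq_image:
  "last_piece_puzzles m P Q =
    (\<lambda>(M, x, y). append_column M x y) ` (SIGMA M : puzzles m P. extensions M Q)"
proof (intro equalityI subsetI)
  fix N assume N: "N \<in> last_piece_puzzles m P Q"
  then have "standard_matrix (m + 1 + 1) N" by (simp add: last_piece_puzzles_def)
  then obtain M x y where M: "standard_matrix (m + 1) M" and xy: "(x, y) \<in> new_columns (m + 1)"
    and eq: "N = append_column M x y"
    by (rule append_column_surj)
  have dim: "dim_col M = m + 1" using M by (auto simp: standard_matrix_def)
  have "M \<in> puzzles m P" "(x, y) \<in> extensions M Q"
    using N M xy reduction_piece_append_column[OF M xy]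
    by (auto simp: puzzles_iff extensions_def last_piece_puzzles_def eq dim)
  then show "N \<in> (\<lambda>(M, x, y). append_column M x y) ` (SIGMA M : puzzles m P. extensions M Q)"
    by (intro image_eqI[of _ _ "(M, x, y)"]) (auto simp: eq)
next
  fix N assume "N \<in> (\<lambda>(M, x, y). append_column M x y) ` (SIGMA M : puzzles m P. extensions M Q)"
  then obtain M x y where *: "M \<in> puzzles m P" "(x, y) \<in> extensions M Q" "N = append_column M x y"
    by auto
  then have M: "standard_matrix (m + 1) M" by (simp add: puzzles_iff)
  then have dim: "dim_col M = m + 1" by (auto simp: standard_matrix_def)
  have xy: "(x, y) \<in> new_columns (m + 1)" using * by (simp add: extensions_def dim)
  show "N \<in> last_piece_puzzles m P Q"
    using * standard_append_column[OF M xy] reduction_piece_append_column[OF M xy]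
    by (auto simp: puzzles_iff extensions_def last_piece_puzzles_def dim)
qed

lemma sum_last_piece_puzzles:
  "(\<Sum>N \<in> last_piece_puzzles m P Q. g N) =
    (\<Sum>M \<in> puzzles m P. \<Sum>(x, y) \<in> extensions M Q. g (append_column M x y))"
proof -
  have "M = M' \<and> x = x' \<and> y = y'"
    if "M \<in> puzzles m P" "M' \<in> puzzles m P" "append_column M x y = append_column M' x' y'"
    for M M' x y x' y'
    using that append_column_inject[of M "m + 1" M'] by (simp add: puzzles_iff standard_matrix_def)
  then have "inj_on (\<lambda>(M, x, y). append_column M x y) (SIGMA M : puzzles m P. extensions M Q)"
    by (intro inj_onI) (auto 0 4)
  then show ?thesis
    unfolding last_piece_puzzles_eq_image
    by (subst sum.reindex) (simp_all add: sum.Sigma finite_puzzles finite_extensions split_def)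
qed

lemma card_last_piece_puzzles:
  "card (last_piece_puzzles m P Q) = (\<Sum>M \<in> puzzles m P. card (extensions M Q))"
  using sum_last_piece_puzzles[of "\<lambda>_. 1 :: nat" m P Q] by simp

lemma all_less_Suc: "(\<forall>p<Suc m. P p) \<longleftrightarrow> (\<forall>p<m. P p) \<and> P m"
  by (auto simp: less_Suc_eq)

lemma puzzles_Suc_singleton: "puzzles (Suc m) {Q} = last_piece_puzzles m {Q} Q"
  by (auto simp: puzzles_iff last_piece_puzzles_def less_Suc_eq)

text \<open>A \<open>B\<close>-piece followed by another piece would share with it a column that
  increases downwards in the former and decreases downwards in the latter, since both pieces start
  with a decreasing column.\<close>

lemma puzzles_Suc_pair:
  assumes "A $$ (1, 0) < A $$ (0, 0)" "B $$ (1, 0) < B $$ (0, 0)" "B $$ (0, 1) < B $$ (1, 1)"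
  shows "puzzles (Suc m) {A, B} = last_piece_puzzles m {A} A \<union> last_piece_puzzles m {A} B"
proof -
  have "reduction (piece N p) = A" if N: "N \<in> puzzles (Suc m) {A, B}" and p: "p < m" for N p
  proof (rule ccontr)
    assume "reduction (piece N p) \<noteq> A"
    moreover have "reduction (piece N p) \<in> {A, B}" using N p by (simp add: puzzles_iff)
    ultimately have "reduction (piece N p) = B" by simp
    moreover have "reduction (piece N (Suc p)) \<in> {A, B}" using N p by (simp add: puzzles_iff)
    \<comment> \<open>Both inequalities concern column \<open>p + 1\<close> of \<open>N\<close> and
      contradict each other.\<close>
    ultimately have "piece N p $$ (0, 1) < piece N p $$ (1, 1)"
      "piece N (Suc p) $$ (1, 0) < piece N (Suc p) $$ (0, 0)"
      using assms reduction_less_iff[of 0 "piece N p" 1 1 1]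
        reduction_less_iff[of 1 "piece N (Suc p)" 0 0 0]
      by (auto simp: piece_def)
    then show False by (simp add: piece_def)
  qed
  note only_A = this
  show ?thesis
  proof (intro equalityI subsetI)
    fix N assume N: "N \<in> puzzles (Suc m) {A, B}"
    then have "standard_matrix (m + 2) N" "reduction (piece N m) \<in> {A, B}"
      by (simp_all add: puzzles_iff)
    moreover have "\<forall>p<m. reduction (piece N p) \<in> {A}"
      using only_A[OF N] by simp
    ultimately show "N \<in> last_piece_puzzles m {A} A \<union> last_piece_puzzles m {A} B"
      by (auto simp: last_piece_puzzles_def)
  qed (auto simp: puzzles_iff last_piece_puzzles_def all_less_Suc)
qed

section \<open>Order chains of the pieces and the admissible last columns\<close>

lemma all_less_2: "(\<forall>i<2. P i) \<longleftrightarrow> P 0 \<and> P (1 :: nat)"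
  by (auto simp: numeral_2_eq_2 less_Suc_eq)

lemma standard_pieces:
  "standard_piece A2" "standard_piece B1" "standard_piece B2" "standard_piece B3"
  "standard_piece B4" "standard_piece B5" "standard_piece B6"
proof -
  have I: "{0..<2} \<times> {0..<2} = {(0, 0), (0, 1), (1, 0), (1, 1) :: nat \<times> nat}"
    by (auto simp: numeral_2_eq_2 less_Suc_eq)
  have *: "standard_piece M"
    if "dim_row M = 2" "dim_col M = 2" "distinct [M $$ (0, 0), M $$ (0, 1), M $$ (1, 0), M $$ (1, 1)]"
      "set [M $$ (0, 0), M $$ (0, 1), M $$ (1, 0), M $$ (1, 1)] \<subseteq> {1..4}" for M
    using that carrier_matI[of M 2 2] unfolding standard_piece_def standard_matrix_iff I all_less_2 by simp
  show "standard_piece A2"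
    by (rule *) (simp_all add: A2_def mat_of_rows_list_def)
  show "standard_piece B1"
    by (rule *) (simp_all add: B1_def mat_of_rows_list_def)
  show "standard_piece B2"
    by (rule *) (simp_all add: B2_def mat_of_rows_list_def)
  show "standard_piece B3"
    by (rule *) (simp_all add: B3_def mat_of_rows_list_def)
  show "standard_piece B4"
    by (rule *) (simp_all add: B4_def mat_of_rows_list_def)
  show "standard_piece B5"
    by (rule *) (simp_all add: B5_def mat_of_rows_list_def)
  show "standard_piece B6"
    by (rule *) (simp_all add: B6_def mat_of_rows_list_def)
qed

text \<open>Each chain lists the four cells in the order in which the piece carries 1, 2, 3, 4; the
  sixteen comparisons collapse to it.\<close>

lemma reduction_eq_iff_chain:
  assumes "M \<in> carrier_mat 2 2" "inj_on (\<lambda>(i, j). M $$ (i, j)) ({0..<2} \<times> {0..<2})"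
  defines "t \<equiv> M $$ (0, 0)" and "b \<equiv> M $$ (1, 0)" and "x \<equiv> M $$ (0, 1)" and "y \<equiv> M $$ (1, 1)"
  shows "reduction M = A2 \<longleftrightarrow> b < y \<and> y < t \<and> t < x"
    "reduction M = B1 \<longleftrightarrow> b < x \<and> x < y \<and> y < t"
    "reduction M = B2 \<longleftrightarrow> b < x \<and> x < t \<and> t < y"
    "reduction M = B3 \<longleftrightarrow> b < t \<and> t < x \<and> x < y"
    "reduction M = B4 \<longleftrightarrow> x < b \<and> b < t \<and> t < y"
    "reduction M = B5 \<longleftrightarrow> x < b \<and> b < y \<and> y < t"
    "reduction M = B6 \<longleftrightarrow> x < y \<and> y < b \<and> b < t"
proof -
  note eq = standard_pieces[THEN reduction_eq_iff, OF assms(1,2)]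
  show "reduction M = A2 \<longleftrightarrow> b < y \<and> y < t \<and> t < x"
    unfolding eq all_less_2 t_def[symmetric] b_def[symmetric] x_def[symmetric] y_def[symmetric]
    by (simp add: A2_def mat_of_rows_list_def) linarith
  show "reduction M = B1 \<longleftrightarrow> b < x \<and> x < y \<and> y < t"
    unfolding eq all_less_2 t_def[symmetric] b_def[symmetric] x_def[symmetric] y_def[symmetric]
    by (simp add: B1_def mat_of_rows_list_def) linarith
  show "reduction M = B2 \<longleftrightarrow> b < x \<and> x < t \<and> t < y"
    unfolding eq all_less_2 t_def[symmetric] b_def[symmetric] x_def[symmetric] y_def[symmetric]
    by (simp add: B2_def mat_of_rows_list_def) linarith
  show "reduction M = B3 \<longleftrightarrow> b < t \<and> t < x \<and> x < y"
    unfolding eq all_less_2 t_def[symmetric] b_def[symmetric] x_def[symmetric] y_def[symmetric]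
    by (simp add: B3_def mat_of_rows_list_def) linarith
  show "reduction M = B4 \<longleftrightarrow> x < b \<and> b < t \<and> t < y"
    unfolding eq all_less_2 t_def[symmetric] b_def[symmetric] x_def[symmetric] y_def[symmetric]
    by (simp add: B4_def mat_of_rows_list_def) linarith
  show "reduction M = B5 \<longleftrightarrow> x < b \<and> b < y \<and> y < t"
    unfolding eq all_less_2 t_def[symmetric] b_def[symmetric] x_def[symmetric] y_def[symmetric]
    by (simp add: B5_def mat_of_rows_list_def) linarith
  show "reduction M = B6 \<longleftrightarrow> x < y \<and> y < b \<and> b < t"
    unfolding eq all_less_2 t_def[symmetric] b_def[symmetric] x_def[symmetric] y_def[symmetric]
    by (simp add: B6_def mat_of_rows_list_def) linarith
qed


text \<open>The assumption \<open>t\<close> says that the last top entry is the maximum of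
  \<open>M\<close>. Lifting raises it and \<open>b\<close> by the number of new entries placed below
  each, so every chain becomes a range condition on \<open>x\<close> and \<open>y\<close> in terms
  of \<open>b\<close>. For instance \<open>B3\<close> puts both new entries above everything else,
  which leaves a single column.\<close>

lemma extensions_eq:
  assumes "standard_matrix (m + 1) M" and t: "M $$ (0, m) = 2 * m + 2"
  defines "b \<equiv> M $$ (1, m)"
  shows "extensions M A2 = {2 * m + 4} \<times> {b<..2 * m + 2}"
    "extensions M B1 = {(x, y). b < x \<and> x < y \<and> y \<le> 2 * m + 3}"
    "extensions M B2 = {b<..2 * m + 2} \<times> {2 * m + 4}"
    "extensions M B3 = {(2 * m + 3, 2 * m + 4)}"
    "extensions M B4 = {1..b} \<times> {2 * m + 4}"
    "extensions M B5 = {1..b} \<times> {b + 1<..2 * m + 3}"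
    "extensions M B6 = {(x, y). 0 < x \<and> x < y \<and> y \<le> b + 1}"
proof -
  have M: "M \<in> carrier_mat 2 (m + 1)" and inj: "inj_on (\<lambda>(i, j). M $$ (i, j)) ({0..<2} \<times> {0..<m + 1})"
    and entry: "\<And>i j. i < 2 \<Longrightarrow> j < m + 1 \<Longrightarrow> 1 \<le> M $$ (i, j) \<and> M $$ (i, j) \<le> 2 * m + 2"
    using assms(1) by (auto simp: standard_matrix_iff)
  have dim: "dim_col M = m + 1" using M by simp
  have "b \<noteq> 2 * m + 2"
    using inj_onD[OF inj, of "(0, m)" "(1, m)"] t by (auto simp: b_def)
  then have b: "1 \<le> b" "b < 2 * m + 2"
    using entry[of 1 m] by (simp_all add: b_def)
  have ext: "(x, y) \<in> extensions M Q \<longleftrightarrow> x \<in> {1..2 * m + 4} \<and> y \<in> {1..2 * m + 4} \<and> x \<noteq> y \<and>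
      reduction (piece (append_column M x y) m) = Q" for x y Q
    by (auto simp: extensions_def new_columns_def dim)
  have last_piece: "piece (append_column M x y) m \<in> carrier_mat 2 2"
      "inj_on (\<lambda>(i, j). piece (append_column M x y) m $$ (i, j)) ({0..<2} \<times> {0..<2})"
    if "x \<in> {1..2 * m + 4}" "y \<in> {1..2 * m + 4}" "x \<noteq> y" for x y
    using standard_matrix_imp_piece[OF standard_append_column[OF assms(1)], of x y m] that
    by (auto simp: new_columns_def)
  have entries: "piece (append_column M x y) m $$ (0, 0) = skip2 x y (2 * m + 2)"
    "piece (append_column M x y) m $$ (1, 0) = skip2 x y b"
    "piece (append_column M x y) m $$ (0, 1) = x"
    "piece (append_column M x y) m $$ (1, 1) = y" for x y
    using M t by (simp_all add: piece_def append_column_def b_def)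
  note chain = reduction_eq_iff_chain[OF last_piece, unfolded entries]
  show "extensions M A2 = {2 * m + 4} \<times> {b<..2 * m + 2}"
    using b by (auto simp: ext chain) (auto simp: skip2_def split: if_splits)
  show "extensions M B1 = {(x, y). b < x \<and> x < y \<and> y \<le> 2 * m + 3}"
    using b by (auto simp: ext chain) (auto simp: skip2_def split: if_splits)
  show "extensions M B2 = {b<..2 * m + 2} \<times> {2 * m + 4}"
    using b by (auto simp: ext chain) (auto simp: skip2_def split: if_splits)
  show "extensions M B3 = {(2 * m + 3, 2 * m + 4)}"
    using b by (auto simp: ext chain) (auto simp: skip2_def split: if_splits)
  show "extensions M B4 = {1..b} \<times> {2 * m + 4}"
    using b by (auto simp: ext chain) (auto simp: skip2_def split: if_splits)
  show "extensions M B5 = {1..b} \<times> {b + 1<..2 * m + 3}"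
    using b by (auto simp: ext chain) (auto simp: skip2_def split: if_splits)
  show "extensions M B6 = {(x, y). 0 < x \<and> x < y \<and> y \<le> b + 1}"
    using b by (auto simp: ext chain) (auto simp: skip2_def split: if_splits)
qed

text \<open>The pairs are the two-element subsets of \<open>{l<..h}\<close>. In the induction the
  pairs with \<open>y = Suc h\<close> supply the Pascal increment, and truncated subtraction covers
  \<open>h <= l\<close>.\<close>

lemma card_increasing_pairs:
  "card {(x, y). l < x \<and> x < y \<and> y \<le> (h :: nat)} = (h - l) choose 2"
proof (induction h)
  case 0
  have "{(x, y). l < x \<and> x < y \<and> y \<le> (0 :: nat)} = {}" by auto
  then show ?case by (simp only:) simp
next
  case (Suc h)
  let ?S = "\<lambda>h. {(x, y). l < x \<and> x < y \<and> y \<le> (h :: nat)}"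
  have "?S (Suc h) = ?S h \<union> {l<..h} \<times> {Suc h}" by (auto simp: le_Suc_eq)
  moreover have "finite (?S h)"
    by (rule finite_subset[of _ "{..h} \<times> {..h}"]) auto
  moreover have "?S h \<inter> {l<..h} \<times> {Suc h} = {}" by auto
  ultimately have "card (?S (Suc h)) = (h - l choose 2) + (h - l)"
    using Suc by (simp add: card_Un_disjoint)
  then show ?case
    by (cases "l \<le> h") (simp_all add: Suc_diff_le numeral_2_eq_2)
qed

section \<open>Distribution of the last bottom entry in puzzles built from \<open>A2\<close>\<close>

lemma puzzles_1_standard_piece:
  assumes "standard_piece Q"
  shows "puzzles 1 {Q} = {Q}"
proof -
  have "piece M 0 = M" if "standard_matrix 2 M" for M
    using that by (intro eq_matI) (auto simp: piece_def standard_matrix_def)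
  then show ?thesis
    using assms reduction_id[of 2] by (auto simp: puzzles_iff standard_piece_def numeral_2_eq_2)
qed

text \<open>Appending by \<open>A2\<close> places the new top entry above the old maximum, so the
  maximum moves along the top row. This supplies the assumption of \<open>extensions_eq\<close> at
  every stage.\<close>

lemma puzzles_A2_last_top:
  "M \<in> puzzles (Suc m) {A2} \<Longrightarrow> M $$ (0, Suc m) = 2 * m + 4"
proof (induction m arbitrary: M)
  case 0
  then show ?case
    using puzzles_1_standard_piece[OF standard_pieces(1)] by (simp add: A2_def mat_of_rows_list_def)
next
  case (Suc m)
  then obtain M' x y where *: "M' \<in> puzzles (Suc m) {A2}" "(x, y) \<in> extensions M' A2" "M = append_column M' x y"
    unfolding puzzles_Suc_singleton[of "Suc m"] last_piece_puzzles_eq_image by auto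
  then have M': "standard_matrix (Suc m + 1) M'" by (simp add: puzzles_iff)
  moreover have "M' $$ (0, Suc m) = 2 * Suc m + 2" using Suc.IH[OF *(1)] by simp
  ultimately have "x = 2 * Suc m + 4"
    using extensions_eq(1)[of "Suc m" M'] *(2) by simp
  moreover have "dim_col M' = m + 2" using M' by (auto simp: standard_matrix_def)
  ultimately show ?case
    by (simp add: *(3) append_column_def)
qed

text \<open>This says that \<open>catalan_triangle m j\<close> puzzles have last bottom entry
  \<open>m + 2 + j\<close>. The arbitrary test function \<open>h\<close> carries the induction:
  appending a column replaces it by its sum over the admissible new bottom entries.\<close>

lemma sum_puzzles_A2:
  fixes h :: "nat \<Rightarrow> real"
  shows "(\<Sum>M \<in> puzzles (Suc m) {A2}. h (M $$ (1, Suc m))) =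
    (\<Sum>j\<le>m. catalan_triangle m j * h (m + 2 + j))"
proof (induction m arbitrary: h)
  case 0
  then show ?case
    using puzzles_1_standard_piece[OF standard_pieces(1)]
    by (simp add: A2_def mat_of_rows_list_def catalan_triangle_0 numeral_2_eq_2)
next
  case (Suc m)
  let ?P = "puzzles (Suc m) {A2}"
  have "(\<Sum>M \<in> puzzles (Suc (Suc m)) {A2}. h (M $$ (1, Suc (Suc m)))) =
      (\<Sum>M \<in> ?P. \<Sum>(x, y) \<in> extensions M A2. h (append_column M x y $$ (1, Suc (Suc m))))"
    unfolding puzzles_Suc_singleton[of "Suc m"] by (rule sum_last_piece_puzzles)
  also have "\<dots> = (\<Sum>M \<in> ?P. \<Sum>y \<in> {M $$ (1, Suc m)<..2 * m + 4}. h y)"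
  proof (rule sum.cong[OF refl])
    fix M assume M: "M \<in> ?P"
    then have std: "standard_matrix (Suc m + 1) M" by (simp add: puzzles_iff)
    then have dim: "dim_col M = m + 2" by (auto simp: standard_matrix_def)
    have ext: "extensions M A2 = {2 * Suc m + 4} \<times> {M $$ (1, Suc m)<..2 * Suc m + 2}"
      using puzzles_A2_last_top[OF M] by (intro extensions_eq(1)[OF std]) simp
    have e: "2 * Suc m + 2 = 2 * m + 4" by simp
    show "(\<Sum>(x, y) \<in> extensions M A2. h (append_column M x y $$ (1, Suc (Suc m)))) =
        (\<Sum>y \<in> {M $$ (1, Suc m)<..2 * m + 4}. h y)"
      unfolding ext e sum.cartesian_product[symmetric] by (simp add: append_column_def dim)
  qed
  \<comment> \<open>The induction hypothesis is applied to the function sending \<open>b\<close> to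
    the sum of \<open>h\<close> over \<open>{b<..2 * m + 4}\<close>.\<close>
  also have "\<dots> = (\<Sum>j\<le>m. catalan_triangle m j * (\<Sum>y \<in> {m + 2 + j<..2 * m + 4}. h y))"
    by (rule Suc.IH)
  also have "\<dots> = (\<Sum>j\<le>m. \<Sum>i \<in> {j..Suc m}. catalan_triangle m j * h (m + 3 + i))"
  proof (rule sum.cong[OF refl])
    fix j assume "j \<in> {..m}"
    have "(\<Sum>y \<in> {m + 2 + j<..2 * m + 4}. h y) = (\<Sum>i \<in> {j..Suc m}. h (m + 3 + i))"
      by (rule sum.reindex_bij_witness[of _ "\<lambda>i. m + 3 + i" "\<lambda>y. y - (m + 3)"]) auto
    then show "catalan_triangle m j * (\<Sum>y \<in> {m + 2 + j<..2 * m + 4}. h y) =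
        (\<Sum>i \<in> {j..Suc m}. catalan_triangle m j * h (m + 3 + i))"
      by (simp only: sum_distrib_left)
  qed
  \<comment> \<open>The added term vanishes because the formula gives
    \<open>catalan_triangle m (Suc m) = 0\<close>; the triangular double sum can now be
    interchanged.\<close>
  also have "\<dots> = (\<Sum>j\<le>Suc m. \<Sum>i \<in> {j..Suc m}. catalan_triangle m j * h (m + 3 + i))"
    by (simp add: catalan_triangle_def)
  also have "\<dots> = (\<Sum>i\<le>Suc m. \<Sum>j\<le>i. catalan_triangle m j * h (m + 3 + i))"
  proof -
    let ?f = "\<lambda>j i. catalan_triangle m j * h (m + 3 + i)"
    have "(\<Sum>j\<le>Suc m. \<Sum>i \<in> {j..Suc m}. ?f j i) = (\<Sum>j\<le>Suc m. \<Sum>i \<in> {i \<in> {..Suc m}. j \<le> i}. ?f j i)"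
      by (intro sum.cong) auto
    also have "\<dots> = (\<Sum>i\<le>Suc m. \<Sum>j \<in> {j \<in> {..Suc m}. j \<le> i}. ?f j i)"
      by (rule sum.swap_restrict) simp_all
    also have "\<dots> = (\<Sum>i\<le>Suc m. \<Sum>j\<le>i. ?f j i)"
      by (intro sum.cong) auto
    finally show ?thesis .
  qed
  \<comment> \<open>The inner sums are the partial sums of row \<open>m\<close>, that is, the
    entries of row \<open>m + 1\<close>.\<close>
  also have "\<dots> = (\<Sum>i\<le>Suc m. catalan_triangle (Suc m) i * h (m + 3 + i))"
    by (simp only: sum_distrib_right[symmetric] sum_catalan_triangle)
  finally show ?case
    by (simp add: numeral_2_eq_2 numeral_3_eq_3)
qed

text \<open>Identifies the total of row \<open>p\<close>, which counts the puzzles with only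
  \<open>A2\<close> pieces, as a shifted Catalan number.\<close>

lemma catalan_triangle_Suc_self: "catalan_triangle (Suc p) p = shifted_catalan p"
proof -
  have "(2 * p + 2) choose (p + 1) = 2 * ((2 * p + 1) choose (p + 1))"
    using binomial_symmetric[of p "2 * p + 1"] by simp
  moreover have "catalan_triangle (Suc p) p = 2 / (real p + 2) * real ((2 * p + 1) choose (p + 1))"
  proof -
    have "Suc p + p = 2 * p + 1" by simp
    then show ?thesis
      unfolding catalan_triangle_def by (simp only:) (simp add: add.commute del: binomial_Suc_Suc)
  qed
  ultimately show ?thesis
    by (simp add: shifted_catalan_def del: binomial_Suc_Suc)
qed

section \<open>Assembling the six counts\<close>

lemma card_extensions:
  assumes M: "M \<in> puzzles (Suc m) {A2}"
  defines "b \<equiv> M $$ (1, Suc m)"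
  shows "card (extensions M B1) = (2 * m + 5 - b) choose 2"
    "card (extensions M B2) = 2 * m + 4 - b"
    "card (extensions M B3) = 1"
    "card (extensions M B4) = b"
    "card (extensions M B5) = b * (2 * m + 4 - b)"
    "card (extensions M B6) = (b + 1) choose 2"
proof -
  have "standard_matrix (Suc m + 1) M" "M $$ (0, Suc m) = 2 * Suc m + 2"
    using M puzzles_A2_last_top[OF M] by (simp_all add: puzzles_iff)
  note eq = extensions_eq[OF this, folded b_def]
  have "2 * Suc m + 3 = 2 * m + 5" "2 * Suc m + 2 = 2 * m + 4" by simp_all
  note eq = eq[unfolded this]
  show "card (extensions M B1) = (2 * m + 5 - b) choose 2"
    unfolding eq card_increasing_pairs ..
  show "card (extensions M B2) = 2 * m + 4 - b" "card (extensions M B3) = 1" "card (extensions M B4) = b"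
    unfolding eq by simp_all
  have "2 * m + 5 - (b + 1) = 2 * m + 4 - b" by simp
  then show "card (extensions M B5) = b * (2 * m + 4 - b)"
    unfolding eq card_cartesian_product card_greaterThanAtMost by simp
  show "card (extensions M B6) = (b + 1) choose 2"
    unfolding eq card_increasing_pairs by simp
qed

text \<open>The puzzles are split by their last piece. Those ending in \<open>A2\<close> consist of
  \<open>A2\<close> only and give the Catalan term; those ending in \<open>B\<close> are counted by
  summing the number \<open>w\<close> of extensions over the distribution of the last bottom
  entry.\<close>

lemma num_puzzles_A2_pair:
  assumes B: "B $$ (1, 0) < B $$ (0, 0)" "B $$ (0, 1) < B $$ (1, 1)"
    and w: "\<And>M. M \<in> puzzles (Suc m) {A2} \<Longrightarrow> card (extensions M B) = w (M $$ (1, Suc m))"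
  shows "real (num_puzzles (m + 2) ({A2} \<union> {B})) =
    (\<Sum>k = 1..m + 1. real (w (m + 1 + k)) * catalan_triangle m (k - 1)) + shifted_catalan (m + 1)"
proof -
  have A2: "A2 $$ (1, 0) < A2 $$ (0, 0)" "A2 $$ (1, 1) < A2 $$ (0, 1)"
    by (simp_all add: A2_def mat_of_rows_list_def)
  \<comment> \<open>The last columns of \<open>A2\<close> and \<open>B\<close> are ordered
    oppositely, so the two pieces differ.\<close>
  have "last_piece_puzzles (Suc m) {A2} A2 \<inter> last_piece_puzzles (Suc m) {A2} B = {}"
    using A2(2) B(2) by (auto simp: last_piece_puzzles_def)
  then have "num_puzzles (m + 2) ({A2} \<union> {B}) =
      card (last_piece_puzzles (Suc m) {A2} A2) + card (last_piece_puzzles (Suc m) {A2} B)"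
    using puzzles_Suc_pair[OF A2(1) B, of "Suc m"]
    by (simp add: num_puzzles_def card_Un_disjoint finite_last_piece_puzzles insert_commute)
  moreover have "real (card (last_piece_puzzles (Suc m) {A2} A2)) = shifted_catalan (m + 1)"
    using sum_puzzles_A2[of "\<lambda>_. 1" "Suc m"]
    by (simp add: puzzles_Suc_singleton[of "Suc m", symmetric] sum_catalan_triangle catalan_triangle_Suc_self
        del: sum.atMost_Suc)
  moreover have "real (card (last_piece_puzzles (Suc m) {A2} B)) =
      (\<Sum>k = 1..m + 1. real (w (m + 1 + k)) * catalan_triangle m (k - 1))"
  proof -
    have "real (card (last_piece_puzzles (Suc m) {A2} B)) =
        (\<Sum>M \<in> puzzles (Suc m) {A2}. real (w (M $$ (1, Suc m))))"
      by (simp add: card_last_piece_puzzles w)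
    also have "\<dots> = (\<Sum>j\<le>m. catalan_triangle m j * real (w (m + 2 + j)))"
      by (rule sum_puzzles_A2)
    \<comment> \<open>The index is \<open>k = j + 1\<close>, so the last bottom entry
      \<open>m + 2 + j\<close> reads \<open>m + 1 + k\<close>.\<close>
    also have "\<dots> = (\<Sum>k = 1..Suc m. real (w (m + 1 + k)) * catalan_triangle m (k - 1))"
      unfolding One_nat_def sum.atLeast1_atMost_eq lessThan_Suc_atMost by (simp add: mult.commute)
    finally show ?thesis by simp
  qed
  ultimately show ?thesis by simp
qed

theorem theorem4p7:
  fixes n :: nat
  assumes "2 \<le> n"
  shows
    "(real (num_puzzles n ({A2} \<union> {B1})) =
        (\<Sum>k = 1..n - 1. real ((n - k + 2) choose 2) * catalan_triangle (n - 2) (k - 1))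
          + shifted_catalan (n - 1)
      \<and> (\<Sum>k = 1..n - 1. real ((n - k + 2) choose 2) * catalan_triangle (n - 2) (k - 1))
          + shifted_catalan (n - 1)
        = 1 / (real n + 2) * real ((2 * n + 2) choose (n + 1)))
   \<and> (real (num_puzzles n ({A2} \<union> {B2})) =
        (\<Sum>k = 1..n - 1. (real n - real k + 1) * catalan_triangle (n - 2) (k - 1))
          + shifted_catalan (n - 1)
      \<and> (\<Sum>k = 1..n - 1. (real n - real k + 1) * catalan_triangle (n - 2) (k - 1))
          + shifted_catalan (n - 1)
        = 2 / (real n + 1) * real ((2 * n) choose n))
   \<and> real (num_puzzles n ({A2} \<union> {B3})) = shifted_catalan (n - 1) + shifted_catalan (n - 2)
   \<and> (real (num_puzzles n ({A2} \<union> {B4})) =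
        (\<Sum>k = 1..n - 1. (real n + real k - 1) * catalan_triangle (n - 2) (k - 1))
          + shifted_catalan (n - 1)
      \<and> (\<Sum>k = 1..n - 1. (real n + real k - 1) * catalan_triangle (n - 2) (k - 1))
          + shifted_catalan (n - 1)
        = 2 * real ((2 * n - 2) choose (n - 1)))
   \<and> (real (num_puzzles n ({A2} \<union> {B5})) =
        (\<Sum>k = 1..n - 1. (real n + real k - 1) * (real n - real k + 1)
            * catalan_triangle (n - 2) (k - 1))
          + shifted_catalan (n - 1)
      \<and> (\<Sum>k = 1..n - 1. (real n + real k - 1) * (real n - real k + 1)
            * catalan_triangle (n - 2) (k - 1))
          + shifted_catalan (n - 1)
        = (2 * real n ^ 2 + 4) / ((real n + 1) * (real n + 2)) * real ((2 * n) choose n))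
   \<and> (real (num_puzzles n ({A2} \<union> {B6})) =
        (\<Sum>k = 1..n - 1. real ((n + k) choose 2) * catalan_triangle (n - 2) (k - 1))
          + shifted_catalan (n - 1)
      \<and> (\<Sum>k = 1..n - 1. real ((n + k) choose 2) * catalan_triangle (n - 2) (k - 1))
          + shifted_catalan (n - 1)
        = (real n ^ 2 - real n + 4) / (4 * real n - 2) * real ((2 * n + 1) choose (n - 1)))"
proof -
  obtain m where n: "n = m + 2"
    using assms by (metis add.commute le_Suc_ex)
  let ?t = "\<lambda>k. catalan_triangle (n - 2) (k - 1)"
  \<comment> \<open>Here \<open>w\<close> counts extensions as a natural number in terms of the last
    bottom entry, and \<open>v\<close> is the corresponding real weight in terms of
    \<open>k\<close>.\<close>
  have count: "real (num_puzzles n ({A2} \<union> {B})) =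
      (\<Sum>k = 1..n - 1. v k * ?t k) + shifted_catalan (n - 1)"
    if "B $$ (1, 0) < B $$ (0, 0)" "B $$ (0, 1) < B $$ (1, 1)"
      and "\<And>M. M \<in> puzzles (Suc m) {A2} \<Longrightarrow> card (extensions M B) = w (M $$ (1, Suc m))"
      and "\<And>k. 1 \<le> k \<Longrightarrow> k \<le> m + 1 \<Longrightarrow> real (w (m + 1 + k)) = v k" for B w v
  proof -
    have "(\<Sum>k = 1..m + 1. real (w (m + 1 + k)) * catalan_triangle m (k - 1)) =
        (\<Sum>k = 1..m + 1. v k * catalan_triangle m (k - 1))"
      by (rule sum.cong) (use that(4) in simp_all)
    then show ?thesis
      using num_puzzles_A2_pair[of B m w, OF that(1-3)] by (simp only: n) simp
  qed
  have B1: "real (num_puzzles n ({A2} \<union> {B1})) =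
      (\<Sum>k = 1..n - 1. real ((n - k + 2) choose 2) * ?t k) + shifted_catalan (n - 1)"
  proof (rule count[OF _ _ card_extensions(1)])
    fix k assume "1 \<le> k" "k \<le> m + 1"
    then have "2 * m + 5 - (m + 1 + k) = n - k + 2" by (simp add: n)
    then show "real ((2 * m + 5 - (m + 1 + k)) choose 2) = real ((n - k + 2) choose 2)"
      by (rule arg_cong)
  qed (simp_all add: B1_def mat_of_rows_list_def)
  have B2: "real (num_puzzles n ({A2} \<union> {B2})) =
      (\<Sum>k = 1..n - 1. (real n - real k + 1) * ?t k) + shifted_catalan (n - 1)"
    by (rule count[OF _ _ card_extensions(2)]) (auto simp: B2_def mat_of_rows_list_def n of_nat_diff)
  have B3: "real (num_puzzles n ({A2} \<union> {B3})) = (\<Sum>k = 1..n - 1. 1 * ?t k) + shifted_catalan (n - 1)"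
    \<comment> \<open>There is always exactly one extension, so the sum is a plain row total, later
      identified as \<open>shifted_catalan (n - 2)\<close>.\<close>
    by (rule count[OF _ _ card_extensions(3)]) (auto simp: B3_def mat_of_rows_list_def)
  have B4: "real (num_puzzles n ({A2} \<union> {B4})) =
      (\<Sum>k = 1..n - 1. (real n + real k - 1) * ?t k) + shifted_catalan (n - 1)"
    by (rule count[OF _ _ card_extensions(4)]) (auto simp: B4_def mat_of_rows_list_def n)
  have B5: "real (num_puzzles n ({A2} \<union> {B5})) =
      (\<Sum>k = 1..n - 1. (real n + real k - 1) * (real n - real k + 1) * ?t k) + shifted_catalan (n - 1)"
    by (rule count[OF _ _ card_extensions(5)]) (auto simp: B5_def mat_of_rows_list_def n of_nat_diff, simp add: algebra_simps)
  have B6: "real (num_puzzles n ({A2} \<union> {B6})) =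
      (\<Sum>k = 1..n - 1. real ((n + k) choose 2) * ?t k) + shifted_catalan (n - 1)"
    by (rule count[OF _ _ card_extensions(6)]) (auto simp: B6_def mat_of_rows_list_def n)
  show ?thesis
    using B1 B2 B3 B4 B5 B6 sum_catalan_triangle_closed_forms[OF assms] by simp
qed

end
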